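(* Consider two consecutive time periods $t-1$ and $t$, and the following system of linear constraints in the real variables $(p_{t-1},p_t,u_{t-1},u_t,v_t,w_t)$: $$p_{t-1}\ge\underline P\,u_{t-1},\qquad p_t\ge\underline P\,u_t,$$ $$u_t-u_{t-1}=v_t-w_t,\qquad v_t\le u_t,\qquad w_t\le 1-u_t,$$ $$p_t-p_{t-1}\le(\overline P^{\mathrm{su}}-\underline P-\overline R^{\mathrm{up}})\,v_t+(\underline P+\overline R^{\mathrm{up}})\,u_t-\underline P\,u_{t-1},$$ $$p_{t-1}-p_t\le(\overline P^{\mathrm{sd}}-\underline P-\overline R^{\mathrm{dn}})\,w_t+(\underline P+\overline R^{\mathrm{dn}})\,u_{t-1}-\underline P\,u_t,$$ $$p_t\le\overline P\,u_t-(\overline P-\overline P^{\mathrm{su}})\,v_t,\qquad p_{t-1}\le\overline P\,u_{t-1}-(\overline P-\overline P^{\mathrm{sd}})\,w_t .$$ Let $X$ be the set of all $(p_{t-1},p_t,u_{t-1},u_t,v_t,w_t)$ with $p_{t-1},p_t\ge 0$ and $u_{t-1},u_t,v_t,w_t\in\{0,1\}$ satisfying this system. Then the convex hull of $X$ is exactly the set of all real $(p_{t-1},p_t,u_{t-1},u_t,v_t,w_t)$ satisfying this system together with $v_t\ge 0$ and $w_t\ge 0$.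
   Context: Single-unit, two-period unit commitment problem with ramping and start-up/shut-down capabilities (the two-period version of "Model II-E2"). $p_s,u_s$ are production and commitment status in period $s\in\{t-1,t\}$; $v_t,w_t$ are the start-up and shut-down indicators in period $t$. Parameters: minimum and maximum output $0\le\underline P\le\overline P$; maximum ramp-up and ramp-down per period $\overline R^{\mathrm{up}},\overline R^{\mathrm{dn}}\ge 0$; maximum output when starting up $\overline P^{\mathrm{su}}$ and when shutting down $\overline P^{\mathrm{sd}}$, with $\underline P\le\overline P^{\mathrm{su}}\le\underline P+\overline R^{\mathrm{up}}$ and $\underline P\le\overline P^{\mathrm{sd}}\le\underline P+\overline R^{\mathrm{dn}}$. *)

theory Defs
  imports "HOL-Analysis.Analysis"
begin

text \<open>
  Suffix \<open>0\<close> stands for period t-1 and suffix \<open>1\<close> for period t: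
  \<open>p0\<close>, \<open>p1\<close> are productions, \<open>u0\<close>, \<open>u1\<close> commitment statuses, and
  \<open>v\<close>, \<open>w\<close> the start-up and shut-down indicators of period t.
  A point is the tuple \<open>(p0, p1, u0, u1, v, w)\<close>.
  Parameters: output bounds \<open>Pmin\<close>, \<open>Pmax\<close>; ramp limits \<open>Rup\<close>, \<open>Rdn\<close>;
  maximum outputs \<open>Psu\<close> at start-up and \<open>Psd\<close> at shut-down.
\<close>

type_synonym uc_point = "real \<times> real \<times> real \<times> real \<times> real \<times> real"

definition uc_system ::
  "real \<Rightarrow> real \<Rightarrow> real \<Rightarrow> real \<Rightarrow> real \<Rightarrow> real \<Rightarrow>
   real \<Rightarrow> real \<Rightarrow> real \<Rightarrow> real \<Rightarrow> real \<Rightarrow> real \<Rightarrow> bool" where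
  "uc_system Pmin Pmax Rup Rdn Psu Psd p0 p1 u0 u1 v w \<longleftrightarrow>
     p0 \<ge> Pmin * u0 \<and>
     p1 \<ge> Pmin * u1 \<and>
     u1 - u0 = v - w \<and>
     v \<le> u1 \<and>
     w \<le> 1 - u1 \<and>
     p1 - p0 \<le> (Psu - Pmin - Rup) * v + (Pmin + Rup) * u1 - Pmin * u0 \<and>
     p0 - p1 \<le> (Psd - Pmin - Rdn) * w + (Pmin + Rdn) * u0 - Pmin * u1 \<and>
     p1 \<le> Pmax * u1 - (Pmax - Psu) * v \<and>
     p0 \<le> Pmax * u0 - (Pmax - Psd) * w"

definition uc_feasible ::
  "real \<Rightarrow> real \<Rightarrow> real \<Rightarrow> real \<Rightarrow> real \<Rightarrow> real \<Rightarrow> uc_point set" where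
  "uc_feasible Pmin Pmax Rup Rdn Psu Psd =
     {(p0, p1, u0, u1, v, w).
        p0 \<ge> 0 \<and> p1 \<ge> 0 \<and>
        u0 \<in> {0, 1} \<and> u1 \<in> {0, 1} \<and> v \<in> {0, 1} \<and> w \<in> {0, 1} \<and>
        uc_system Pmin Pmax Rup Rdn Psu Psd p0 p1 u0 u1 v w}"

end

theory Submission imports Defs begin

text \<open>
  The equation \<open>u1 - u0 = v - w\<close> together with \<open>v \<le> u1\<close> and \<open>w \<le> 1 - u1\<close> leaves four
  binary patterns: the unit stays on, starts up, shuts down, or stays off.  A relaxed point assigns
  them the weights \<open>u1 - v\<close> (equal to \<open>u0 - w\<close>), \<open>v\<close>, \<open>w\<close> and
  \<open>1 - u1 - w\<close>, which are nonnegative and add up to 1.  Hence the status coordinates already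
  form a convex combination, and what remains is to distribute the productions: \<open>p0\<close> over
  stay-on and shut-down, \<open>p1\<close> over stay-on and start-up.

  If \<open>y\<close> and \<open>z\<close> are the weighted productions of the start-up and shut-down patterns, then
  the stay-on pattern receives \<open>p1 - y\<close> and \<open>p0 - z\<close>.  The output bounds confine \<open>y\<close>
  and \<open>z\<close> to intervals, and the two ramp limits confine \<open>y - z\<close> to an interval.  Three such
  conditions have a common solution as soon as all intervals are nonempty and the range of
  \<open>y - z\<close> over the box meets the third interval (\<open>box_meets_strip\<close>).  Written out, these
  conditions are the inequalities of the system or consequences of the order of the parameters
  (\<open>production_split\<close>); this is the elimination of \<open>y\<close> and \<open>z\<close> from the disjunctive
  (extended) formulation of the hull.

  The converse inclusion is immediate, because the relaxed set is an intersection of half-spaces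
  that contains every feasible point.
\<close>

section \<open>The relaxed set is convex\<close>

lemma convex_uc_relaxation:
  "convex {(p0, p1, u0, u1, v, w).
     uc_system Pmin Pmax Rup Rdn Psu Psd p0 p1 u0 u1 v w \<and> v \<ge> 0 \<and> w \<ge> 0}"
    (is "convex ?P")
proof -
  define H :: "uc_point \<Rightarrow> real \<Rightarrow> uc_point set" where "H a b = {x. a \<bullet> x \<le> b}" for a b
  have H: "convex (H a b)" for a b
    unfolding H_def by (rule convex_halfspace_le)
  have "?P = H (-1, 0, Pmin, 0, 0, 0) 0 \<inter> H (0, -1, 0, Pmin, 0, 0) 0
      \<inter> H (0, 0, -1, 1, -1, 1) 0 \<inter> H (0, 0, 1, -1, 1, -1) 0
      \<inter> H (0, 0, 0, -1, 1, 0) 0 \<inter> H (0, 0, 0, 1, 0, 1) 1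
      \<inter> H (-1, 1, Pmin, -(Pmin + Rup), -(Psu - Pmin - Rup), 0) 0
      \<inter> H (1, -1, -(Pmin + Rdn), Pmin, 0, -(Psd - Pmin - Rdn)) 0
      \<inter> H (0, 1, 0, -Pmax, Pmax - Psu, 0) 0 \<inter> H (1, 0, -Pmax, 0, 0, Pmax - Psd) 0
      \<inter> H (0, 0, 0, 0, -1, 0) 0 \<inter> H (0, 0, 0, 0, 0, -1) 0"
    unfolding H_def uc_system_def by (auto simp: algebra_simps)
  then show ?thesis
    by (simp only:) (intro convex_Int H)
qed

section \<open>Splitting the productions\<close>

lemma box_meets_strip:
  fixes l0 h0 l1 h1 s t :: real
  assumes "l0 \<le> h0" "l1 \<le> h1" "s \<le> t" "s \<le> h1 - l0" "l1 - h0 \<le> t"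
  obtains y z where "l1 \<le> y" "y \<le> h1" "l0 \<le> z" "z \<le> h0" "s \<le> y - z" "y - z \<le> t"
proof -
  \<comment> \<open>\<open>d\<close> is the smallest difference attainable in the box that reaches the strip.\<close>
  define d where "d = max s (l1 - h0)"
  define z where "z = max l0 (l1 - d)"
  show ?thesis
    by (rule that[of "z + d" z]) (use assms in \<open>auto simp: d_def z_def\<close>)
qed

text \<open>
  Here \<open>a\<close> is the weight of the stay-on pattern, and the premises are the constraints of the
  system with \<open>u1 = a + v\<close> and \<open>u0 = a + w\<close>.  In these variables
  each bound is the sum of the weighted bounds of the patterns.  Eliminating \<open>y\<close> and \<open>z\<close>
  requires every lower bound to lie below every upper bound, and each such comparison turns out to be
  one of these sums or a weighted comparison of parameters, so no further inequality is needed.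
\<close>

lemma production_split:
  fixes Pmin Pmax Rup Rdn Psu Psd a v w p0 p1 :: real
  assumes par: "Pmin \<le> Pmax" "0 \<le> Rup" "0 \<le> Rdn" "Pmin \<le> Psu" "Pmin \<le> Psd"
    and wt: "0 \<le> a" "0 \<le> v" "0 \<le> w"
    and lower: "Pmin * a + Pmin * w \<le> p0" "Pmin * a + Pmin * v \<le> p1"
    and upper: "p0 \<le> Pmax * a + Psd * w" "p1 \<le> Pmax * a + Psu * v"
    and ramp: "p1 - p0 \<le> Rup * a + Psu * v - Pmin * w" "p0 - p1 \<le> Rdn * a + Psd * w - Pmin * v"
  obtains y z where "Pmin * v \<le> y" "y \<le> Psu * v" "Pmin * w \<le> z" "z \<le> Psd * w"
    "Pmin * a \<le> p0 - z" "p0 - z \<le> Pmax * a" "Pmin * a \<le> p1 - y" "p1 - y \<le> Pmax * a"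
    "(p1 - y) - (p0 - z) \<le> Rup * a" "(p0 - z) - (p1 - y) \<le> Rdn * a"
proof -
  define l1 where "l1 = max (Pmin * v) (p1 - Pmax * a)"
  define h1 where "h1 = min (Psu * v) (p1 - Pmin * a)"
  define l0 where "l0 = max (Pmin * w) (p0 - Pmax * a)"
  define h0 where "h0 = min (Psd * w) (p0 - Pmin * a)"
  have weighted: "Pmin * a \<le> Pmax * a" "0 \<le> Rup * a" "0 \<le> Rdn * a" "Pmin * v \<le> Psu * v"
      "Pmin * w \<le> Psd * w"
    using par wt by (simp_all add: mult_right_mono)
  have "l0 \<le> h0" "l1 \<le> h1"
    using lower upper weighted unfolding l0_def h0_def l1_def h1_def by auto
  moreover have "p1 - p0 - Rup * a \<le> p1 - p0 + Rdn * a"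
    using weighted by linarith
  moreover have "p1 - p0 - Rup * a \<le> h1 - l0"
    using lower upper ramp weighted unfolding h1_def l0_def by (auto simp: min_def max_def)
  moreover have "l1 - h0 \<le> p1 - p0 + Rdn * a"
    using lower upper ramp weighted unfolding l1_def h0_def by (auto simp: min_def max_def)
  ultimately obtain y z where yz: "l1 \<le> y" "y \<le> h1" "l0 \<le> z" "z \<le> h0"
      "p1 - p0 - Rup * a \<le> y - z" "y - z \<le> p1 - p0 + Rdn * a"
    by (rule box_meets_strip)
  show ?thesis
    by (rule that[of y z]) (use yz in \<open>auto simp: l0_def h0_def l1_def h1_def\<close>)
qed

section \<open>Weighted feasible points\<close>

text \<open>
  Feasible points are needed only after multiplication with their weight.  For weight 0 the weighted
  bounds force the productions to vanish, so any feasible point of the pattern serves; minimum output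
  is always admissible, because the parameters keep it within the limits of the pattern.
\<close>

lemma stay_on_scaled:
  assumes "0 \<le> Pmin" "Pmin \<le> Pmax" "0 \<le> Rup" "0 \<le> Rdn" "0 \<le> a"
    and "Pmin * a \<le> x0" "x0 \<le> Pmax * a" "Pmin * a \<le> x1" "x1 \<le> Pmax * a"
    and "x1 - x0 \<le> Rup * a" "x0 - x1 \<le> Rdn * a"
  obtains q where "q \<in> uc_feasible Pmin Pmax Rup Rdn Psu Psd"
    and "a *\<^sub>R q = (x0, x1, a, a, 0, 0)"
proof (cases "a = 0")
  case True
  show ?thesis
    by (rule that[of "(Pmin, Pmin, 1, 1, 0, 0)"])
      (use assms True in \<open>auto simp: uc_feasible_def uc_system_def\<close>)
next
  case False
  with assms have "0 < a" by simp
  then have bounds: "Pmin \<le> x0 / a" "x0 / a \<le> Pmax" "Pmin \<le> x1 / a" "x1 / a \<le> Pmax"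
      "x1 / a - x0 / a \<le> Rup" "x0 / a - x1 / a \<le> Rdn"
    using assms by (simp_all add: field_simps)
  show ?thesis
    by (rule that[of "(x0 / a, x1 / a, 1, 1, 0, 0)"])
      (use assms bounds \<open>0 < a\<close> in \<open>auto simp: uc_feasible_def uc_system_def\<close>)
qed

lemma start_up_scaled:
  assumes "0 \<le> Pmin" "Pmin \<le> Psu" "0 \<le> v" "Pmin * v \<le> y" "y \<le> Psu * v"
  obtains q where "q \<in> uc_feasible Pmin Pmax Rup Rdn Psu Psd"
    and "v *\<^sub>R q = (0, y, 0, v, v, 0)"
proof (cases "v = 0")
  case True
  show ?thesis
    by (rule that[of "(0, Pmin, 0, 1, 1, 0)"])
      (use assms True in \<open>auto simp: uc_feasible_def uc_system_def\<close>)
next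
  case False
  with assms have "0 < v" by simp
  then have bounds: "Pmin \<le> y / v" "y / v \<le> Psu"
    using assms by (simp_all add: field_simps)
  show ?thesis
    by (rule that[of "(0, y / v, 0, 1, 1, 0)"])
      (use assms bounds \<open>0 < v\<close> in \<open>auto simp: uc_feasible_def uc_system_def\<close>)
qed

lemma shut_down_scaled:
  assumes "0 \<le> Pmin" "Pmin \<le> Psd" "0 \<le> w" "Pmin * w \<le> z" "z \<le> Psd * w"
  obtains q where "q \<in> uc_feasible Pmin Pmax Rup Rdn Psu Psd"
    and "w *\<^sub>R q = (z, 0, w, 0, 0, w)"
proof (cases "w = 0")
  case True
  show ?thesis
    by (rule that[of "(Pmin, 0, 1, 0, 0, 1)"])
      (use assms True in \<open>auto simp: uc_feasible_def uc_system_def\<close>)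
next
  case False
  with assms have "0 < w" by simp
  then have bounds: "Pmin \<le> z / w" "z / w \<le> Psd"
    using assms by (simp_all add: field_simps)
  show ?thesis
    by (rule that[of "(z / w, 0, 1, 0, 0, 1)"])
      (use assms bounds \<open>0 < w\<close> in \<open>auto simp: uc_feasible_def uc_system_def\<close>)
qed

lemma off_feasible: "0 \<in> uc_feasible Pmin Pmax Rup Rdn Psu Psd"
  by (auto simp: uc_feasible_def uc_system_def zero_prod_def)

text \<open>
  As the all-off point is the origin, its weight is whatever the other three leave over, and
  their weights only have to add up to at most 1.
\<close>

lemma convex_hull_subcombination3:
  assumes "0 \<in> S" "x \<in> S" "y \<in> S" "z \<in> S"
    and "0 \<le> a" "0 \<le> b" "0 \<le> c" "a + b + c \<le> 1"
  shows "a *\<^sub>R x + b *\<^sub>R y + c *\<^sub>R z \<in> convex hull S"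
proof -
  let ?k = "\<lambda>i::nat. [a, b, c, 1 - a - b - c] ! i" and ?f = "\<lambda>i::nat. [x, y, z, 0] ! i"
  have "(\<Sum>i<4. ?k i *\<^sub>R ?f i) \<in> convex hull S"
  proof (rule convex_sum)
    show "(\<Sum>i<4. ?k i) = 1"
      by (simp add: numeral_eq_Suc)
    show "0 \<le> ?k i" if "i \<in> {..<4}" for i
      using that assms by (auto simp: numeral_eq_Suc less_Suc_eq)
    show "?f i \<in> convex hull S" if "i \<in> {..<4}" for i
      using that assms by (auto simp: numeral_eq_Suc less_Suc_eq intro: hull_inc)
  qed (auto simp: convex_convex_hull)
  then show ?thesis
    by (simp add: numeral_eq_Suc)
qed

section \<open>The convex hull\<close>

theorem mainTheorem4:
  fixes Pmin Pmax Rup Rdn Psu Psd :: real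
  assumes "0 \<le> Pmin" and "Pmin \<le> Pmax"
    and "0 \<le> Rup" and "0 \<le> Rdn"
    and "Pmin \<le> Psu" and "Psu \<le> Pmin + Rup"
    and "Pmin \<le> Psd" and "Psd \<le> Pmin + Rdn"
  shows "convex hull (uc_feasible Pmin Pmax Rup Rdn Psu Psd) =
    {(p0, p1, u0, u1, v, w).
       uc_system Pmin Pmax Rup Rdn Psu Psd p0 p1 u0 u1 v w \<and> v \<ge> 0 \<and> w \<ge> 0}"
    (is "convex hull ?X = ?P")
proof
  show "convex hull ?X \<subseteq> ?P"
  proof (rule hull_minimal)
    show "?X \<subseteq> ?P"
      by (auto simp: uc_feasible_def)
    show "convex ?P"
      by (rule convex_uc_relaxation)
  qed
next
  show "?P \<subseteq> convex hull ?X"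
  proof clarify
    fix p0 p1 u0 u1 v w
    assume sys: "uc_system Pmin Pmax Rup Rdn Psu Psd p0 p1 u0 u1 v w" and "0 \<le> v" "0 \<le> w"
    define a where "a = u1 - v"
    have u: "u1 = a + v" "u0 = a + w"
      using sys by (auto simp: a_def uc_system_def)
    have "0 \<le> a" "a + v + w \<le> 1"
      using sys by (auto simp: u uc_system_def)
    have lower: "Pmin * a + Pmin * w \<le> p0" "Pmin * a + Pmin * v \<le> p1"
      and upper: "p0 \<le> Pmax * a + Psd * w" "p1 \<le> Pmax * a + Psu * v"
      and ramp: "p1 - p0 \<le> Rup * a + Psu * v - Pmin * w"
        "p0 - p1 \<le> Rdn * a + Psd * w - Pmin * v"
      using sys by (simp_all add: u uc_system_def algebra_simps)
    obtain y z where y: "Pmin * v \<le> y" "y \<le> Psu * v" and z: "Pmin * w \<le> z" "z \<le> Psd * w"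
      and on: "Pmin * a \<le> p0 - z" "p0 - z \<le> Pmax * a" "Pmin * a \<le> p1 - y" "p1 - y \<le> Pmax * a"
        "(p1 - y) - (p0 - z) \<le> Rup * a" "(p0 - z) - (p1 - y) \<le> Rdn * a"
      using production_split[OF assms(2-5,7) \<open>0 \<le> a\<close> \<open>0 \<le> v\<close> \<open>0 \<le> w\<close> lower upper ramp] .
    obtain q1 where q1: "q1 \<in> ?X" "a *\<^sub>R q1 = (p0 - z, p1 - y, a, a, 0, 0)"
      using stay_on_scaled[OF assms(1-4) \<open>0 \<le> a\<close> on] .
    obtain q2 where q2: "q2 \<in> ?X" "v *\<^sub>R q2 = (0, y, 0, v, v, 0)"
      using start_up_scaled[OF assms(1,5) \<open>0 \<le> v\<close> y] .
    obtain q3 where q3: "q3 \<in> ?X" "w *\<^sub>R q3 = (z, 0, w, 0, 0, w)"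
      using shut_down_scaled[OF assms(1,7) \<open>0 \<le> w\<close> z] .
    have "a *\<^sub>R q1 + v *\<^sub>R q2 + w *\<^sub>R q3 \<in> convex hull ?X"
      by (rule convex_hull_subcombination3) (use off_feasible q1 q2 q3 \<open>0 \<le> a\<close> \<open>0 \<le> v\<close>
        \<open>0 \<le> w\<close> \<open>a + v + w \<le> 1\<close> in auto)
    then show "(p0, p1, u0, u1, v, w) \<in> convex hull ?X"
      unfolding q1(2) q2(2) q3(2) by (simp add: u)
  qed
qed

end
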